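(* Let $m,n$ be positive integers. For the majority-logic decoding algorithm for $C_m\wr S_n$ described in the context, the amount of storage space required by the algorithm (for its look-up table for integer arithmetic) is $\mathrm{O}(mn^2)$, and the space required to perform the algorithm is $\mathrm{O}(mn)$.
   Context: Code: $C_m\wr S_n$ acts imprimitively on $n$ blocks of size $m$, the points being $\{1,\ldots,mn\}$ with blocks $\{1,\ldots,m\},\{m+1,\ldots,2m\},\ldots$. Its elements, written in list form, are the codewords (words of length $mn$). If a list $L$ has a unique most frequently occurring element, it is denoted $\mathrm{majority}(L)$. Decoding algorithm. Input a received word $w=[w_1|w_2|\cdots|w_n]$, where $w_i=[w_{i1},\ldots,w_{im}]$ and each $w_{ij}\in\{1,\ldots,mn\}$. (1) For each $i,j$ compute $q_{ij},s_{ij}$ with $w_{ij}=mq_{ij}+s_{ij}$, $0\leq s_{ij}\leq m-1$. Set $b_{ij}=q_{ij}$ if $s_{ij}\neq 0$ and $b_{ij}=q_{ij}-1$ if $s_{ij}=0$, and let $c_{ij}\in\{0,\ldots,m-1\}$ with $c_{ij}\equiv s_{ij}-j \pmod m$. (2) For each $i$ compute $\widehat{b_i}=\mathrm{majority}[b_{i1},\ldots,b_{im}]$ and $\widehat{c_i}=\mathrm{majority}[c_{i1},\ldots,c_{im}]$ (these are assumed to exist). (3) Output $g=[g_1|\cdots|g_n]$ with $g_i=[g_{i1},\ldots,g_{im}]$, $g_{ij}=m\widehat{b_i}+t_{ij}$, where $t_{ij}\in\{1,\ldots,m\}$ and $t_{ij}\equiv j+\widehat{c_i}\pmod m$. The majority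 of a list with symbols from a set of size $k$ is found using an auxiliary list of $k$ counters, one for each symbol ($k=n$ for the block labels $b_{ij}$ and $k=m$ for the shifts $c_{ij}$). Space model: one unit of space stores one integer. The stored data is a look-up table for the integer arithmetic, which records, for each of the $mn$ symbols and each of $n$ possible divisors, a quotient/remainder pair. The space required to perform the algorithm is the working space needed during its execution: the $mn$ pairs, the auxiliary counter lists, and the reconstructed group element. *)

theory Defs
  imports Complex_Main "HOL-Library.Landau_Symbols"
begin

section \<open>The decoding algorithm\<close>

definition is_majority :: "'a list \<Rightarrow> 'a \<Rightarrow> bool" where
  "is_majority L x \<longleftrightarrow>
     x \<in> set L \<and> (\<forall>y\<in>set L. y \<noteq> x \<longrightarrow> count_list L y < count_list L x)"

definition majority :: "'a list \<Rightarrow> 'a" where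
  "majority L = (THE x. is_majority L x)"

text \<open>Blocks \<open>i\<close> and positions \<open>j\<close> are numbered from 1, list indices from 0.\<close>

definition entry :: "nat \<Rightarrow> int list \<Rightarrow> nat \<Rightarrow> nat \<Rightarrow> int" where
  "entry m w i j = w ! (m * (i - 1) + (j - 1))"

definition block_label :: "nat \<Rightarrow> int list \<Rightarrow> nat \<Rightarrow> nat \<Rightarrow> int" where
  "block_label m w i j =
     (let q = entry m w i j div int m; s = entry m w i j mod int m
      in if s \<noteq> 0 then q else q - 1)"

definition shift :: "nat \<Rightarrow> int list \<Rightarrow> nat \<Rightarrow> nat \<Rightarrow> int" where
  "shift m w i j = (entry m w i j mod int m - int j) mod int m"

definition label_list :: "nat \<Rightarrow> int list \<Rightarrow> nat \<Rightarrow> int list" where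
  "label_list m w i = map (block_label m w i) [1..<m + 1]"

definition shift_list :: "nat \<Rightarrow> int list \<Rightarrow> nat \<Rightarrow> int list" where
  "shift_list m w i = map (shift m w i) [1..<m + 1]"

definition received_words :: "nat \<Rightarrow> nat \<Rightarrow> int list set" where
  "received_words m n =
     {w. length w = m * n \<and> set w \<subseteq> {1..int (m * n)} \<and>
         (\<forall>i\<in>{1..n}. (\<exists>b. is_majority (label_list m w i) b) \<and>
                     (\<exists>c. is_majority (shift_list m w i) c))}"

text \<open>\<open>(x - 1) mod m + 1\<close> is the representative of \<open>x\<close> modulo \<open>m\<close> in \<open>{1..m}\<close>.\<close>

definition decoded_entry :: "nat \<Rightarrow> int list \<Rightarrow> nat \<Rightarrow> nat \<Rightarrow> int" where
  "decoded_entry m w i j =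
     int m * majority (label_list m w i)
     + ((int j + majority (shift_list m w i) - 1) mod int m + 1)"

definition decode :: "nat \<Rightarrow> nat \<Rightarrow> int list \<Rightarrow> int list" where
  "decode m n w =
     concat (map (\<lambda>i. map (decoded_entry m w i) [1..<m + 1]) [1..<n + 1])"


section \<open>Space model\<close>

text \<open>
  A memory is a partial function from addresses to integers, and one unit of space is one
  address holding an integer.
\<close>

definition space_of :: "('a \<Rightarrow> int option) \<Rightarrow> nat" where
  "space_of M = card (dom M)"

text \<open>
  \<open>D\<close> is the set of divisors covered by the table. The decoder divides by \<open>m\<close> by looking up
  the result, so it needs \<open>m \<in> D\<close>.
\<close>

datatype pair_component = Quotient | Remainder

definition lookup_table ::
  "nat \<Rightarrow> nat \<Rightarrow> int set \<Rightarrow> int \<times> int \<times> pair_component \<Rightarrow> int option" where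
  "lookup_table m n D = (\<lambda>(x, d, f).
     if x \<in> {1..int (m * n)} \<and> d \<in> D
     then Some (case f of Quotient \<Rightarrow> x div d | Remainder \<Rightarrow> x mod d)
     else None)"

text \<open>
  The working memory consists of named arrays. A scalar variable is the cell with index 0 of
  its array. Loop counters and temporaries live in the working memory and are charged for.
\<close>

datatype array =
    BlockV | PosV | AddrV | SymV | QuotV | RemV | ResV
  | LabelA | ShiftA
  | LabelCnt | ShiftCnt
  | LabelMaj | ShiftMaj
  | OutA

type_synonym memory = "array \<times> int \<Rightarrow> int option"

datatype expr =
    Const int
  | Cell array expr
  | Input expr
  | Lookup pair_component expr expr
  | Plus expr expr
  | Minus expr expr
  | Times expr expr

datatype com =
    Skip
  | Store array expr expr
  | Seq com com (infixr \<open>;;\<close> 60)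
  | IfLess expr expr com com
  | For array expr expr com

text \<open>
  The table \<open>T\<close> and the received word \<open>w\<close> are read-only. Reading an address that holds no
  integer, or a missing table entry, gives an unspecified value.
\<close>

primrec val_of ::
  "(int \<times> int \<times> pair_component \<Rightarrow> int option) \<Rightarrow> int list \<Rightarrow> expr \<Rightarrow> memory \<Rightarrow> int" where
  "val_of T w (Const k) M = k"
| "val_of T w (Cell a e) M = the (M (a, val_of T w e M))"
| "val_of T w (Input e) M = w ! nat (val_of T w e M - 1)"
| "val_of T w (Lookup f e d) M = the (T (val_of T w e M, val_of T w d M, f))"
| "val_of T w (Plus e e') M = val_of T w e M + val_of T w e' M"
| "val_of T w (Minus e e') M = val_of T w e M - val_of T w e' M"
| "val_of T w (Times e e') M = val_of T w e M * val_of T w e' M"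

primrec exec ::
  "(int \<times> int \<times> pair_component \<Rightarrow> int option) \<Rightarrow> int list \<Rightarrow> com \<Rightarrow> memory \<Rightarrow> memory" where
  "exec T w Skip M = M"
| "exec T w (Store a e v) M = M((a, val_of T w e M) \<mapsto> val_of T w v M)"
| "exec T w (c ;; c') M = exec T w c' (exec T w c M)"
| "exec T w (IfLess e e' c c') M =
     (if val_of T w e M < val_of T w e' M then exec T w c M else exec T w c' M)"
| "exec T w (For x lo hi c) M =
     fold (\<lambda>k M. exec T w c (M((x, 0) \<mapsto> k))) [val_of T w lo M..val_of T w hi M] M"

abbreviation Scalar :: "array \<Rightarrow> expr" where
  "Scalar x \<equiv> Cell x (Const 0)"

abbreviation Assign :: "array \<Rightarrow> expr \<Rightarrow> com" where
  "Assign x e \<equiv> Store x (Const 0) e"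


section \<open>The algorithm as a program\<close>

text \<open>The linear position \<open>m * (i - 1) + j\<close> of the \<open>j\<close>-th entry of the \<open>i\<close>-th block.\<close>

definition set_addr :: "nat \<Rightarrow> com" where
  "set_addr m =
     Assign AddrV (Plus (Times (Const (int m)) (Minus (Scalar BlockV) (Const 1))) (Scalar PosV))"

definition step1 :: "nat \<Rightarrow> nat \<Rightarrow> com" where
  "step1 m n =
     For BlockV (Const 1) (Const (int n)) (
       For PosV (Const 1) (Const (int m)) (
         set_addr m ;;
         Assign QuotV (Lookup Quotient (Input (Scalar AddrV)) (Const (int m))) ;;
         Assign RemV (Lookup Remainder (Input (Scalar AddrV)) (Const (int m))) ;;
         IfLess (Const 0) (Scalar RemV)
           (Store LabelA (Scalar AddrV) (Scalar QuotV))
           (Store LabelA (Scalar AddrV) (Minus (Scalar QuotV) (Const 1))) ;;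
         IfLess (Scalar RemV) (Scalar PosV)
           (Store ShiftA (Scalar AddrV)
             (Minus (Plus (Scalar RemV) (Const (int m))) (Scalar PosV)))
           (Store ShiftA (Scalar AddrV) (Minus (Scalar RemV) (Scalar PosV)))))"

text \<open>
  The majority of the current block of the array \<open>a\<close>, whose entries are symbols in
  \<open>{0..<k}\<close>. The \<open>k\<close> counters are reset and used again for each block.
\<close>

definition find_majority :: "nat \<Rightarrow> nat \<Rightarrow> array \<Rightarrow> array \<Rightarrow> array \<Rightarrow> com" where
  "find_majority m k a cnt maj =
     For SymV (Const 0) (Const (int k - 1)) (Store cnt (Scalar SymV) (Const 0)) ;;
     For PosV (Const 1) (Const (int m)) (
       set_addr m ;;
       Store cnt (Cell a (Scalar AddrV))
         (Plus (Cell cnt (Cell a (Scalar AddrV))) (Const 1))) ;;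
     Store maj (Scalar BlockV) (Const 0) ;;
     For SymV (Const 1) (Const (int k - 1)) (
       IfLess (Cell cnt (Cell maj (Scalar BlockV))) (Cell cnt (Scalar SymV))
         (Store maj (Scalar BlockV) (Scalar SymV))
         Skip)"

definition step2 :: "nat \<Rightarrow> nat \<Rightarrow> com" where
  "step2 m n =
     For BlockV (Const 1) (Const (int n)) (
       find_majority m n LabelA LabelCnt LabelMaj ;;
       find_majority m m ShiftA ShiftCnt ShiftMaj)"

definition step3 :: "nat \<Rightarrow> nat \<Rightarrow> com" where
  "step3 m n =
     For BlockV (Const 1) (Const (int n)) (
       For PosV (Const 1) (Const (int m)) (
         set_addr m ;;
         Assign ResV (Plus (Scalar PosV) (Cell ShiftMaj (Scalar BlockV))) ;;
         IfLess (Const (int m)) (Scalar ResV)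
           (Assign ResV (Minus (Scalar ResV) (Const (int m))))
           Skip ;;
         Store OutA (Scalar AddrV)
           (Plus (Times (Const (int m)) (Cell LabelMaj (Scalar BlockV))) (Scalar ResV))))"

definition decoder :: "nat \<Rightarrow> nat \<Rightarrow> com" where
  "decoder m n = step1 m n ;; step2 m n ;; step3 m n"

definition run :: "nat \<Rightarrow> nat \<Rightarrow> int set \<Rightarrow> int list \<Rightarrow> memory" where
  "run m n D w = exec (lookup_table m n D) w (decoder m n) Map.empty"


section \<open>Space requirements\<close>

definition storage_space :: "nat \<Rightarrow> nat \<Rightarrow> int set \<Rightarrow> nat" where
  "storage_space m n D = space_of (lookup_table m n D)"

text \<open>
  Memory is never released, so the final memory of a run contains every address that
  was in use at any time.
\<close>

definition working_space :: "nat \<Rightarrow> nat \<Rightarrow> int set \<Rightarrow> nat" where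
  "working_space m n D = Max ((\<lambda>w. space_of (run m n D w)) ` received_words m n)"

definition pos_pairs :: "(nat \<times> nat) filter" where
  "pos_pairs = principal {(m, n). 0 < m \<and> 0 < n}"


section \<open>The program computes the decoded word\<close>

lemma fold_upto_invariant:
  assumes "P lo M" and "lo \<le> hi + 1"
    and "\<And>k M. lo \<le> k \<Longrightarrow> k \<le> hi \<Longrightarrow> P k M \<Longrightarrow> P (k + 1) (f k M)"
  shows "P (hi + 1) (fold f [lo..hi] M)"
  using assms
proof (induction "nat (hi + 1 - lo)" arbitrary: lo M)
  case 0
  have "lo = hi + 1" using 0(1) 0(3) by linarith
  with 0(2) show ?case by simp
next
  case (Suc x)
  then have le: "lo \<le> hi" by linarith
  have "P (hi + 1) (fold f [lo + 1..hi] (f lo M))"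
  proof (rule Suc.hyps(1))
    show "x = nat (hi + 1 - (lo + 1))" using Suc.hyps(2) by linarith
    show "P (lo + 1) (f lo M)" by (rule Suc.prems(3)) (use le Suc.prems(1) in blast)+
    show "lo + 1 \<le> hi + 1" using le by simp
    show "P (k + 1) (f k M)" if "lo + 1 \<le> k" "k \<le> hi" "P k M" for k M
      by (rule Suc.prems(3)) (use that in linarith, use that in blast, use that in blast)
  qed
  then show ?case using le by (simp add: upto_rec1)
qed

lemma exec_For:
  assumes "P l M" "val_of T w lo M = l" "val_of T w hi M = h" "l \<le> h + 1"
    and "\<And>k M. l \<le> k \<Longrightarrow> k \<le> h \<Longrightarrow> P k M \<Longrightarrow> P (k + 1) (exec T w c (M((x, 0) \<mapsto> k)))"
  shows "P (h + 1) (exec T w (For x lo hi c) M)"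
  unfolding exec.simps assms(2,3)
  by (rule fold_upto_invariant[where P = P, OF assms(1) assms(4) assms(5)])

lemma is_majority_unique:
  assumes "is_majority L x" "is_majority L y" shows "x = y"
proof (rule ccontr)
  assume "x \<noteq> y"
  then have "count_list L y < count_list L x" "count_list L x < count_list L y"
    using assms by (auto simp: is_majority_def)
  then show False by simp
qed

lemma majority_eq: "is_majority L x \<Longrightarrow> majority L = x"
  unfolding majority_def by (rule the_equality) (simp_all add: is_majority_unique)

lemma addr_less:
  assumes "i \<in> {1..n}" "j \<in> {1..m}" shows "m * (i - 1) + (j - 1) < m * (n::nat)"
proof -
  have "m * (i - 1) + (j - 1) < m * (i - 1) + m" using assms by auto
  also have "\<dots> = m * i" using assms by (cases i) auto
  also have "\<dots> \<le> m * n" using assms by simp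
  finally show ?thesis .
qed

lemma entry_range:
  assumes "w \<in> received_words m n" "i \<in> {1..n}" "j \<in> {1..m}"
  shows "1 \<le> entry m w i j" "entry m w i j \<le> int m * int n"
proof -
  have "entry m w i j \<in> set w"
    using assms addr_less[OF assms(2,3)] by (auto simp: entry_def received_words_def)
  then show "1 \<le> entry m w i j" "entry m w i j \<le> int m * int n"
    using assms(1) by (auto simp: received_words_def)
qed

lemma block_label_range:
  assumes "w \<in> received_words m n" "i \<in> {1..n}" "j \<in> {1..m}"
  shows "0 \<le> block_label m w i j \<and> block_label m w i j < int n"
proof -
  let ?x = "entry m w i j" let ?m = "int m"
  have m: "?m > 0" using assms by auto
  note r = entry_range[OF assms]
  have e: "?x = ?m * (?x div ?m) + ?x mod ?m" by simp
  have s: "0 \<le> ?x mod ?m" "?x mod ?m < ?m" using m by auto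
  have q0: "0 \<le> ?x div ?m" using m r by (simp add: pos_imp_zdiv_nonneg_iff)
  show ?thesis
  proof (cases "?x mod ?m = 0")
    case True
    then have "?m * (?x div ?m) \<le> ?m * int n" "1 \<le> ?m * (?x div ?m)" using r e by auto
    then have "?x div ?m \<le> int n" "?x div ?m \<noteq> 0" using m by auto
    with q0 have "?x div ?m \<le> int n" "0 < ?x div ?m" by linarith+
    then show ?thesis using True by (simp add: block_label_def Let_def)
  next
    case False
    then have "?m * (?x div ?m) < ?m * int n" using r e s by linarith
    then have "?x div ?m < int n" using m by simp
    then show ?thesis using False q0 by (simp add: block_label_def Let_def)
  qed
qed

lemma shift_range: "m > 0 \<Longrightarrow> 0 \<le> shift m w i j \<and> shift m w i j < int m"
  by (simp add: shift_def)

definition addr :: "nat \<Rightarrow> int \<Rightarrow> int \<Rightarrow> int" where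
  "addr m i j = int m * (i - 1) + j"

lemma addr_nat: "i \<ge> 1 \<Longrightarrow> j \<ge> 1 \<Longrightarrow> nat (addr m i j - 1) = m * (nat i - 1) + (nat j - 1)"
proof -
  assume a: "i \<ge> 1" "j \<ge> 1"
  have "addr m i j - 1 = int (m * (nat i - 1) + (nat j - 1))"
    using a by (simp add: addr_def of_nat_diff)
  then show ?thesis by (simp only: nat_int)
qed

lemma addr_inj:
  assumes "addr m i j = addr m i' j'" "1 \<le> j" "j \<le> int m" "1 \<le> j'" "j' \<le> int m"
  shows "i = i' \<and> j = j'"
proof -
  have "i = (addr m i j - 1) div int m + 1" if "1 \<le> j" "j \<le> int m" for i j
  proof -
    have "(addr m i j - 1) div int m = ((j - 1) + (i - 1) * int m) div int m"
      by (simp add: addr_def algebra_simps)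
    also have "\<dots> = (i - 1) + (j - 1) div int m" using that by (intro div_mult_self1) simp
    also have "(j - 1) div int m = 0" using that by (intro div_pos_pos_trivial) auto
    finally show ?thesis by simp
  qed
  from this[of j i] this[of j' i'] have "i = i'" using assms by simp
  then show ?thesis using assms(1) by (simp add: addr_def)
qed

lemma exec_set_addr:
  "M (BlockV,0) = Some i \<Longrightarrow> M (PosV,0) = Some j \<Longrightarrow>
   exec T w (set_addr m) M = M((AddrV,0) \<mapsto> addr m i j)"
  by (simp add: set_addr_def addr_def)

text \<open>\<open>stored m n f a i j M\<close>: the array \<open>a\<close> holds the values of \<open>f\<close> at all positions lexicographically
  before the \<open>j\<close>-th entry of block \<open>i\<close>.\<close>

definition before :: "int \<Rightarrow> int \<Rightarrow> int \<Rightarrow> int \<Rightarrow> bool" where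
  "before i j i' j' \<longleftrightarrow> i' < i \<or> i' = i \<and> j' < j"

definition stored :: "nat \<Rightarrow> nat \<Rightarrow> (nat \<Rightarrow> nat \<Rightarrow> int) \<Rightarrow> array \<Rightarrow> int \<Rightarrow> int \<Rightarrow> memory \<Rightarrow> bool" where
  "stored m n f a i j M \<longleftrightarrow>
    (\<forall>i'\<in>{1..int n}. \<forall>j'\<in>{1..int m}. before i j i' j' \<longrightarrow> M (a, addr m i' j') = Some (f (nat i') (nat j')))"

lemma stored_step:
  assumes "stored m n f a i j M" "i \<in> {1..int n}" "j \<in> {1..int m}"
    "M' (a, addr m i j) = Some (f (nat i) (nat j))"
    "\<And>k. k \<noteq> addr m i j \<Longrightarrow> M' (a,k) = M (a,k)"
  shows "stored m n f a i (j+1) M'"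
  unfolding stored_def
proof (intro ballI impI)
  fix i' j' assume h: "i'\<in>{1..int n}" "j'\<in>{1..int m}" "before i (j+1) i' j'"
  show "M' (a, addr m i' j') = Some (f (nat i') (nat j'))"
  proof (cases "i' = i \<and> j' = j")
    case True then show ?thesis using assms(4) by simp
  next
    case False
    then have "before i j i' j'" using h by (auto simp: before_def)
    moreover have "addr m i' j' \<noteq> addr m i j" using False h assms addr_inj[of m i' j' i j] by auto
    ultimately show ?thesis using assms h by (auto simp: stored_def)
  qed
qed

lemma stored_cong:
  assumes "stored m n f a i j M" "\<And>k. M' (a,k) = M (a,k)" shows "stored m n f a i j M'"
  using assms(1) unfolding stored_def assms(2) .

lemma stored_next: "stored m n f a i (int m + 1) M \<Longrightarrow> stored m n f a (i+1) 1 M"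
  unfolding stored_def
proof (intro ballI impI)
  fix i' j' assume h: "\<forall>i'\<in>{1..int n}. \<forall>j'\<in>{1..int m}. before i (int m + 1) i' j' \<longrightarrow> M (a, addr m i' j') = Some (f (nat i') (nat j'))"
    "i'\<in>{1..int n}" "j'\<in>{1..int m}" "before (i+1) 1 i' j'"
  then have "before i (int m + 1) i' j'" by (auto simp: before_def)
  then show "M (a, addr m i' j') = Some (f (nat i') (nat j'))" using h by blast
qed

lemma stored_start: "stored m n f a 1 1 M"
  by (auto simp: stored_def before_def)


lemma step1_correct:
  assumes w: "w \<in> received_words m n" and D: "int m \<in> D" and m: "m > 0" 
  shows "stored m n (block_label m w) LabelA (int n + 1) 1 (exec (lookup_table m n D) w (step1 m n) M)
       \<and> stored m n (shift m w) ShiftA (int n + 1) 1 (exec (lookup_table m n D) w (step1 m n) M)"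
proof -
  let ?T = "lookup_table m n D"
  define P where "P = (\<lambda>i j M. stored m n (block_label m w) LabelA i j M \<and> stored m n (shift m w) ShiftA i j M)"
  have "P (int n + 1) 1 (exec ?T w (step1 m n) M)"
    unfolding step1_def
  proof (rule exec_For[where P = "\<lambda>i M. P i 1 M" and l = 1], goal_cases)
    case 1 then show ?case by (simp add: stored_start P_def)
  next
    case (5 i M)
    let ?M = "M((BlockV,0) \<mapsto> i)"
    define Inv where "Inv = (\<lambda>j M. P i j M \<and> M (BlockV,0) = Some i)"
    have start: "Inv 1 ?M" using 5(3) by (auto elim!: stored_cong simp: P_def Inv_def)
    have "Inv (int m + 1) (exec ?T w (For PosV (Const 1) (Const (int m)) (
         set_addr m ;;
         Assign QuotV (Lookup Quotient (Input (Scalar AddrV)) (Const (int m))) ;;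
         Assign RemV (Lookup Remainder (Input (Scalar AddrV)) (Const (int m))) ;;
         IfLess (Const 0) (Scalar RemV)
           (Store LabelA (Scalar AddrV) (Scalar QuotV))
           (Store LabelA (Scalar AddrV) (Minus (Scalar QuotV) (Const 1))) ;;
         IfLess (Scalar RemV) (Scalar PosV)
           (Store ShiftA (Scalar AddrV)
             (Minus (Plus (Scalar RemV) (Const (int m))) (Scalar PosV)))
           (Store ShiftA (Scalar AddrV) (Minus (Scalar RemV) (Scalar PosV))))) ?M)"
    proof (rule exec_For[where P = Inv and l = 1], goal_cases)
      case (5 j N)
      note IH = 5(3)[unfolded Inv_def]
      let ?x = "entry m w (nat i) (nat j)"
      have ij: "i \<in> {1..int n}" "j \<in> {1..int m}" using 5 \<open>1 \<le> i\<close> \<open>i \<le> int n\<close> by auto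
      have x: "w ! nat (addr m i j - 1) = ?x" using ij by (simp add: addr_nat entry_def)
      have "nat i \<in> {1..n}" "nat j \<in> {1..m}" using ij by auto
      note xr = entry_range[OF w this]
      have T: "?T (?x, int m, Quotient) = Some (?x div int m)"
         "?T (?x, int m, Remainder) = Some (?x mod int m)"
        using xr D by (auto simp: lookup_table_def)
      have s: "0 \<le> ?x mod int m" "?x mod int m < int m" using m by auto
      have lab: "block_label m w (nat i) (nat j) = (if 0 < ?x mod int m then ?x div int m else ?x div int m - 1)"
        using s by (auto simp: block_label_def Let_def)
      have sh: "shift m w (nat i) (nat j) = (if ?x mod int m < j then ?x mod int m + int m - j else ?x mod int m - j)"
      proof (cases "?x mod int m < j")
        case True
        have "(?x mod int m - j) mod int m = (?x mod int m - j + int m) mod int m" by simp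
        also have "\<dots> = ?x mod int m - j + int m"
          using True s ij by (intro mod_pos_pos_trivial) auto
        finally show ?thesis using True ij by (simp add: shift_def)
      next
        case False
        then have "(?x mod int m - j) mod int m = ?x mod int m - j"
          using s ij by (intro mod_pos_pos_trivial) auto
        then show ?thesis using False ij by (simp add: shift_def)
      qed
      define N' where "N' = N((PosV,0) \<mapsto> j, (AddrV,0) \<mapsto> addr m i j, (QuotV,0) \<mapsto> ?x div int m, (RemV,0) \<mapsto> ?x mod int m,
         (LabelA, addr m i j) \<mapsto> block_label m w (nat i) (nat j), (ShiftA, addr m i j) \<mapsto> shift m w (nat i) (nat j))"
      have "stored m n (block_label m w) LabelA i (j+1) N'"
        by (rule stored_step[of _ _ _ _ i j N]) (use IH ij in \<open>auto simp: P_def N'_def\<close>)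
      moreover have "stored m n (shift m w) ShiftA i (j+1) N'"
        by (rule stored_step[of _ _ _ _ i j N]) (use IH ij in \<open>auto simp: P_def N'_def\<close>)
      ultimately have "P i (j+1) N' \<and> N' (BlockV,0) = Some i" using IH by (simp add: P_def N'_def)
      then show ?case using IH ij unfolding Inv_def
        by (cases "0 < ?x mod int m"; cases "?x mod int m < j")
          (simp_all add: exec_set_addr[where i=i and j=j] x T N'_def lab sh)
    qed (use m start in auto)
    then show ?case by (auto intro!: stored_next simp: P_def Inv_def)
  qed simp_all
  then show ?thesis by (simp add: P_def)
qed

lemma count_list_snoc: "count_list (xs @ [y]) s = count_list xs s + (if y = s then 1 else 0)"
  by simp

lemma find_majority_correct:
  fixes T w
  assumes M: "M (BlockV,0) = Some i" "\<And>j. j \<in> {1..int m} \<Longrightarrow> M (a, addr m i j) = Some (f j)"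
    and f: "\<And>j. j \<in> {1..int m} \<Longrightarrow> 0 \<le> f j \<and> f j < int k"
    and maj: "is_majority (map f [1..int m]) x"
    and a: "(a, cnt, maj) \<in> {(LabelA, LabelCnt, LabelMaj), (ShiftA, ShiftCnt, ShiftMaj)}"
    and m: "m > 0" and k: "k > 0"
  defines "M' \<equiv> exec T w (find_majority m k a cnt maj) M"
  shows "M' (maj,i) = Some x
     \<and> (\<forall>b s. b \<notin> {SymV, PosV, AddrV, cnt, maj} \<or> b = maj \<and> s \<noteq> i \<longrightarrow> M' (b,s) = M (b,s))"
proof -
  define Fr where "Fr = (\<lambda>N::memory. \<forall>b s. b \<notin> {SymV, PosV, AddrV, cnt, maj} \<or> b = maj \<and> s \<noteq> i \<longrightarrow> N (b,s) = M (b,s))"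
  have FrD: "N (BlockV,0) = Some i" "\<And>j. j \<in> {1..int m} \<Longrightarrow> N (a, addr m i j) = Some (f j)" if "Fr N" for N
    using that M a by (auto simp: Fr_def)
  define C where "C = (\<lambda>N j. \<forall>s\<in>{0..<int k}. N (cnt, s) = Some (int (count_list (map f [1..j - 1]) s)))"
  define M1 where "M1 = exec T w (For SymV (Const 0) (Const (int k - 1)) (Store cnt (Scalar SymV) (Const 0))) M"
  have ne: "cnt \<noteq> SymV" "maj \<noteq> SymV" "cnt \<noteq> maj" "cnt \<noteq> BlockV" "cnt \<noteq> a" "maj \<noteq> a" "a \<noteq> SymV"
     "a \<noteq> PosV" "a \<noteq> AddrV" "cnt \<noteq> PosV" "cnt \<noteq> AddrV"
    using a by auto
  define Z where "Z = (\<lambda>r N. Fr N \<and> (\<forall>s\<in>{0..<r}. N (cnt, s) = Some 0))"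
  have "Z (int k - 1 + 1) M1"
    unfolding M1_def
  proof (rule exec_For[where P = Z and l = 0], goal_cases)
    case 1 show ?case by (simp add: Z_def Fr_def)
  next
    case (5 r N)
    then show ?case using ne by (simp add: Z_def Fr_def)
  qed (use k in auto)
  then have M1: "Fr M1" "C M1 1" by (auto simp: C_def Z_def)
  define M2 where "M2 = exec T w (For PosV (Const 1) (Const (int m)) (
       set_addr m ;;
       Store cnt (Cell a (Scalar AddrV))
         (Plus (Cell cnt (Cell a (Scalar AddrV))) (Const 1)))) M1"
  define I2 where "I2 = (\<lambda>j N. Fr N \<and> C N j)"
  have "I2 (int m + 1) M2"
    unfolding M2_def
  proof (rule exec_For[where P = I2 and l = 1], goal_cases)
    case (5 j N)
    have IH: "Fr N" "C N j" using 5(3) by (simp_all add: I2_def)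
    let ?N = "N((PosV, 0) \<mapsto> j, (AddrV,0) \<mapsto> addr m i j)"
    have j: "j \<in> {1..int m}" using 5 by auto
    have e: "exec T w (set_addr m) (N((PosV, 0) \<mapsto> j)) = ?N"
      by (subst exec_set_addr[where i=i and j=j]) (use FrD(1)[OF IH(1)] in auto)
    have cj: "N (cnt, f j) = Some (int (count_list (map f [1..j - 1]) (f j)))"
      using f[OF j] IH by (auto simp: C_def)
    let ?N' = "?N((cnt, f j) \<mapsto> int (count_list (map f [1..j - 1]) (f j)) + 1)"
    have "maj \<noteq> PosV" "maj \<noteq> AddrV" using a by auto
    then have "Fr ?N'" using IH(1) ne unfolding Fr_def by auto
    moreover have "C ?N' (j + 1)"
      using IH(2) ne 5(1) by (simp add: C_def upto_rec2[of 1 j])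
    ultimately show ?case
      using FrD(2)[OF IH(1) j] cj ne by (simp add: e I2_def)
  qed (use M1 m in \<open>auto simp: I2_def\<close>)
  then have M2: "Fr M2" "C M2 (int m + 1)" by (auto simp: I2_def)
  define c where "c = (\<lambda>s. int (count_list (map f [1..int m]) s))"
  have M2c: "M2 (cnt, s) = Some (c s)" if "s \<in> {0..<int k}" for s
    using M2(2) that by (auto simp: C_def c_def)
  define M3 where "M3 = M2((maj, i) \<mapsto> 0)"
  have M3: "exec T w (Store maj (Scalar BlockV) (Const 0)) M2 = M3"
    using FrD(1)[OF M2(1)] by (simp add: M3_def)
  define I3 where "I3 = (\<lambda>s N. Fr N \<and> (\<forall>r\<in>{0..<int k}. N (cnt, r) = Some (c r)) \<and>
      (\<exists>b. N (maj, i) = Some b \<and> 0 \<le> b \<and> b < s \<and> (\<forall>r\<in>{0..<s}. c r \<le> c b)))"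
  have "I3 (int k - 1 + 1)
      (exec T w (For SymV (Const 1) (Const (int k - 1)) (
       IfLess (Cell cnt (Cell maj (Scalar BlockV))) (Cell cnt (Scalar SymV))
         (Store maj (Scalar BlockV) (Scalar SymV))
         Skip)) M3)"
  proof (rule exec_For[where P = I3 and l = 1], goal_cases)
    case 1
    have "c r \<le> c 0" if "r \<in> {0..<1}" for r using that by (cases "r = 0") auto
    then show ?case using M2(1) M2c ne by (simp add: M3_def Fr_def I3_def)
  next
    case (5 s N)
    then have IH: "Fr N" "\<forall>r\<in>{0..<int k}. N (cnt, r) = Some (c r)" by (auto simp: I3_def)
    from 5 obtain b where b: "N (maj, i) = Some b" "0 \<le> b" "b < s" "\<forall>r\<in>{0..<s}. c r \<le> c b" by (auto simp: I3_def)
    have cc: "N (cnt, b) = Some (c b)" "N (cnt, s) = Some (c s)" using 5(1,2) IH(2) b by auto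
    have split: "r \<in> {0..<s+1} \<longleftrightarrow> r = s \<or> r \<in> {0..<s}" for r using 5(1) by auto
    have BV: "N (BlockV,0) = Some i" using FrD(1)[OF IH(1)] .
    have ne': "maj \<noteq> BlockV" using a by auto
    show ?case
    proof (cases "c b < c s")
      case True
      have "\<forall>r\<in>{0..<s+1}. c r \<le> c s" using True b(4) unfolding split by force
      then show ?thesis using 5(1) IH True b BV cc ne ne' by (simp add: Fr_def I3_def)
    next
      case False
      have "\<forall>r\<in>{0..<s+1}. c r \<le> c b" using False b(4) unfolding split by force
      then have "I3 (s + 1) (N((SymV, 0) \<mapsto> s))"
        using 5(1) IH b ne unfolding I3_def
        by (intro conjI exI[of _ b]) (simp_all add: Fr_def)
      then show ?thesis using False b BV cc ne ne' by simp
    qed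
  qed (use k in auto)
  then have "I3 (int k - 1 + 1) M'"
    unfolding M'_def find_majority_def exec.simps(3) M1_def[symmetric] M2_def[symmetric] M3 .
  then obtain b where b: "Fr M'" "M' (maj, i) = Some b" "\<forall>r\<in>{0..<int k}. c r \<le> c b"
    by (auto simp: I3_def)
  have "x \<in> set (map f [1..int m])" using maj by (simp add: is_majority_def)
  moreover then have "x \<in> {0..<int k}" using f by auto
  ultimately have "c x \<le> c b" "c x > 0" using b
    by (simp, metis c_def count_list_0_iff of_nat_0_less_iff neq0_conv)
  have "b = x"
  proof (rule ccontr)
    assume ne: "b \<noteq> x"
    have "b \<in> set (map f [1..int m])"
      using \<open>c x \<le> c b\<close> \<open>c x > 0\<close> by (metis c_def count_list_0_iff of_nat_0 linorder_not_less)
    then have "count_list (map f [1..int m]) b < count_list (map f [1..int m]) x"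
      using maj ne unfolding is_majority_def by blast
    then have "c b < c x" by (simp add: c_def)
    then show False using \<open>c x \<le> c b\<close> by simp
  qed
  then show ?thesis using b unfolding Fr_def by blast
qed

lemma upto_int_nat: "[1..int m] = map int [1..<m + 1]"
proof (induction m)
  case (Suc m)
  have "[1..int (Suc m)] = [1..int m] @ [int (Suc m)]" by (simp add: upto_rec2)
  then show ?case using Suc by simp
qed simp

lemma step2_correct:
  assumes w: "w \<in> received_words m n" and m: "m > 0" and n: "n > 0"
    and L: "stored m n (block_label m w) LabelA (int n + 1) 1 M"
    and S: "stored m n (shift m w) ShiftA (int n + 1) 1 M"
    and i: "i \<in> {1..int n}"
  shows "exec T w (step2 m n) M (LabelMaj, i) = Some (majority (label_list m w (nat i)))
       \<and> exec T w (step2 m n) M (ShiftMaj, i) = Some (majority (shift_list m w (nat i)))"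
proof -
  define P where "P = (\<lambda>r N. (\<forall>s. N (LabelA, s) = M (LabelA, s) \<and> N (ShiftA, s) = M (ShiftA, s)) \<and>
     (\<forall>i\<in>{1..<r}. N (LabelMaj, i) = Some (majority (label_list m w (nat i)))
       \<and> N (ShiftMaj, i) = Some (majority (shift_list m w (nat i)))))"
  have "P (int n + 1) (exec T w (step2 m n) M)"
    unfolding step2_def
  proof (rule exec_For[where P = P and l = 1], goal_cases)
    case (5 i N)
    have i: "i \<in> {1..int n}" "nat i \<in> {1..n}" using 5 by auto
    define N0 where "N0 = N((BlockV,0) \<mapsto> i)"
    define N1 where "N1 = exec T w (find_majority m n LabelA LabelCnt LabelMaj) N0"
    define N2 where "N2 = exec T w (find_majority m m ShiftA ShiftCnt ShiftMaj) N1"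
    obtain x y where xy: "is_majority (label_list m w (nat i)) x" "is_majority (shift_list m w (nat i)) y"
      using w i(2) unfolding received_words_def by blast
    have l: "label_list m w (nat i) = map (\<lambda>j. block_label m w (nat i) (nat j)) [1..int m]"
      "shift_list m w (nat i) = map (\<lambda>j. shift m w (nat i) (nat j)) [1..int m]"
      by (simp_all add: label_list_def shift_list_def upto_int_nat o_def del: upt_Suc)
    have A: "N (LabelA, addr m i j) = Some (block_label m w (nat i) (nat j))"
         "N (ShiftA, addr m i j) = Some (shift m w (nat i) (nat j))" if "j \<in> {1..int m}" for j
      using L S that i 5 by (auto simp: stored_def before_def P_def)
    have br: "0 \<le> block_label m w (nat i) (nat j) \<and> block_label m w (nat i) (nat j) < int n"
      if "j \<in> {1..int m}" for j
      by (rule block_label_range[OF w i(2)]) (use that in auto)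
    have 1: "N1 (LabelMaj,i) = Some x \<and>
      (\<forall>b s. b \<notin> {SymV, PosV, AddrV, LabelCnt, LabelMaj} \<or> b = LabelMaj \<and> s \<noteq> i \<longrightarrow> N1 (b,s) = N0 (b,s))"
      unfolding N1_def
      by (rule find_majority_correct[where f = "\<lambda>j. block_label m w (nat i) (nat j)"])
         (use A xy l m n br in \<open>auto simp: N0_def\<close>)
    have 2: "N2 (ShiftMaj,i) = Some y \<and>
      (\<forall>b s. b \<notin> {SymV, PosV, AddrV, ShiftCnt, ShiftMaj} \<or> b = ShiftMaj \<and> s \<noteq> i \<longrightarrow> N2 (b,s) = N1 (b,s))"
      unfolding N2_def
      by (rule find_majority_correct[where f = "\<lambda>j. shift m w (nat i) (nat j)"])
         (use 1 A xy l m n shift_range[OF m] in \<open>auto simp: N0_def\<close>)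
    have "N2 (LabelMaj, r) = Some (majority (label_list m w (nat r)))
       \<and> N2 (ShiftMaj, r) = Some (majority (shift_list m w (nat r)))" if "r \<in> {1..<i+1}" for r
    proof (cases "r = i")
      case True
      then show ?thesis using 1 2 majority_eq[OF xy(1)] majority_eq[OF xy(2)] by auto
    next
      case False
      then have "r \<in> {1..<i}" using that by auto
      then show ?thesis using False 1 2 5(3) by (simp add: P_def N0_def)
    qed
    then have "P (i + 1) N2"
      unfolding P_def using 1 2 5(3) by (simp add: P_def N0_def)
    then show ?case by (simp add: N2_def N1_def N0_def)
  qed (auto simp: P_def)
  then show ?thesis using i by (auto simp: P_def)
qed

lemma step3_correct:
  assumes w: "w \<in> received_words m n" and m: "m > 0"
    and M: "\<And>i. i \<in> {1..int n} \<Longrightarrow> M (LabelMaj, i) = Some (majority (label_list m w (nat i)))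
       \<and> M (ShiftMaj, i) = Some (majority (shift_list m w (nat i)))"
  shows "stored m n (decoded_entry m w) OutA (int n + 1) 1 (exec T w (step3 m n) M)"
proof -
  define R where "R = (\<lambda>N::memory. \<forall>i. N (LabelMaj, i) = M (LabelMaj, i) \<and> N (ShiftMaj, i) = M (ShiftMaj, i))"
  define P where "P = (\<lambda>i j N. R N \<and> stored m n (decoded_entry m w) OutA i j N)"
  have "P (int n + 1) 1 (exec T w (step3 m n) M)"
    unfolding step3_def
  proof (rule exec_For[where P = "\<lambda>i M. P i 1 M" and l = 1], goal_cases)
    case 1 then show ?case by (simp add: stored_start P_def R_def)
  next
    case (5 i N0)
    let ?M = "N0((BlockV,0) \<mapsto> i)"
    define Inv where "Inv = (\<lambda>j M. P i j M \<and> M (BlockV,0) = Some i)"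
    have start: "Inv 1 ?M" using 5(3) by (auto elim!: stored_cong simp: P_def R_def Inv_def)
    have "Inv (int m + 1) (exec T w (For PosV (Const 1) (Const (int m)) (
         set_addr m ;;
         Assign ResV (Plus (Scalar PosV) (Cell ShiftMaj (Scalar BlockV))) ;;
         IfLess (Const (int m)) (Scalar ResV)
           (Assign ResV (Minus (Scalar ResV) (Const (int m))))
           Skip ;;
         Store OutA (Scalar AddrV)
           (Plus (Times (Const (int m)) (Cell LabelMaj (Scalar BlockV))) (Scalar ResV)))) ?M)"
    proof (rule exec_For[where P = Inv and l = 1], goal_cases)
      case (5 j N)
      note IH = 5(3)[unfolded Inv_def]
      have ij: "i \<in> {1..int n}" "j \<in> {1..int m}" using 5 \<open>1 \<le> i\<close> \<open>i \<le> int n\<close> by auto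
      let ?b = "majority (label_list m w (nat i))" let ?c = "majority (shift_list m w (nat i))"
      have bc: "N (LabelMaj, i) = Some ?b" "N (ShiftMaj, i) = Some ?c"
        using IH M[OF ij(1)] by (auto simp: P_def R_def)
      have "nat i \<in> {1..n}" using ij by auto
      then obtain y where "is_majority (shift_list m w (nat i)) y" using w unfolding received_words_def by blast
      then have "?c \<in> set (shift_list m w (nat i))" using majority_eq is_majority_def by metis
      then have c: "0 \<le> ?c" "?c < int m" using shift_range[OF m] by (auto simp: shift_list_def)
      let ?t = "if int m < j + ?c then j + ?c - int m else j + ?c"
      have "(j + ?c - 1) mod int m + 1 = ?t"
      proof (cases "int m < j + ?c")
        case True
        have "(j + ?c - 1) mod int m = (j + ?c - 1 - int m) mod int m" by simp
        also have "\<dots> = j + ?c - 1 - int m" using True c ij by (intro mod_pos_pos_trivial) auto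
        finally show ?thesis using True by simp
      next
        case False
        then have "(j + ?c - 1) mod int m = j + ?c - 1" using c ij by (intro mod_pos_pos_trivial) auto
        then show ?thesis using False by simp
      qed
      then have d: "decoded_entry m w (nat i) (nat j) = int m * ?b + ?t"
        using ij by (simp add: decoded_entry_def)
      define N' where "N' = N((PosV,0) \<mapsto> j, (AddrV,0) \<mapsto> addr m i j, (ResV,0) \<mapsto> ?t,
         (OutA, addr m i j) \<mapsto> int m * ?b + ?t)"
      have "stored m n (decoded_entry m w) OutA i (j+1) N'"
        by (rule stored_step[of _ _ _ _ i j N]) (use IH ij d in \<open>auto simp: P_def N'_def\<close>)
      then have "P i (j+1) N' \<and> N' (BlockV,0) = Some i" using IH by (simp add: P_def N'_def R_def)
      then show ?case using IH bc unfolding Inv_def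
        by (simp add: exec_set_addr[where i=i and j=j] N'_def split: if_splits)
    qed (use m start in auto)
    then show ?case by (auto intro!: stored_next simp: P_def Inv_def)
  qed simp_all
  then show ?thesis by (simp add: P_def)
qed

lemma nth_decode:
  assumes "i \<in> {1..n}" "j \<in> {1..m}"
  shows "decode m n w ! (m * (i - 1) + (j - 1)) = decoded_entry m w i j"
proof -
  have "concat (map (\<lambda>i. map (g i) [1..<m + 1]) [1..<n + 1]) ! (m * (i - 1) + (j - 1)) = g i j"
    if "i \<in> {1..n}" "j \<in> {1..m}" for g :: "nat \<Rightarrow> nat \<Rightarrow> int" and n
    using that
  proof (induction n)
    case (Suc n)
    have len: "length (concat (map (\<lambda>i. map (g i) [1..<m + 1]) [1..<n + 1])) = m * n"
      by (simp add: length_concat o_def sum_list_triv)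
    have app: "concat (map (\<lambda>i. map (g i) [1..<m + 1]) [1..<Suc n + 1]) =
        concat (map (\<lambda>i. map (g i) [1..<m + 1]) [1..<n + 1]) @ map (g (Suc n)) [1..<m + 1]"
      by (simp add: upt_Suc_append del: upt_Suc)
    show ?case
    proof (cases "i = Suc n")
      case True
      have "j - 1 < length [1..<m + 1]" "[1..<m + 1] ! (j - 1) = j" using Suc.prems(2) by (auto simp del: upt_Suc)
      then have "map (g (Suc n)) [1..<m + 1] ! (j - 1) = g (Suc n) j" by (simp only: nth_map)
      then show ?thesis
        unfolding app nth_append len using True by simp
    next
      case False
      then have i: "i \<in> {1..n}" using Suc.prems by auto
      show ?thesis
        unfolding app nth_append len
        using Suc.IH[OF i Suc.prems(2)] addr_less[OF i Suc.prems(2)] by (simp only: if_True)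
    qed
  qed simp
  from this[OF assms] show ?thesis unfolding decode_def .
qed

theorem decoder_correct:
  assumes w: "w \<in> received_words m n" and D: "int m \<in> D" and m: "m > 0" and n: "n > 0"
    and l: "l < m * n"
  shows "run m n D w (OutA, int l + 1) = Some (decode m n w ! l)"
proof -
  define i j where "i = l div m + 1" and "j = l mod m + 1"
  have "l div m < n" using l m by (simp add: less_mult_imp_div_less mult.commute)
  then have ij: "i \<in> {1..n}" "j \<in> {1..m}" using m by (auto simp: i_def j_def Suc_leI)
  have l': "l = m * (i - 1) + (j - 1)" by (simp add: i_def j_def)
  have "stored m n (decoded_entry m w) OutA (int n + 1) 1 (run m n D w)"
    unfolding run_def decoder_def exec.simps
    using step1_correct[OF w D m] by (intro step3_correct[OF w m] step2_correct[OF w m n]) auto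
  then have "run m n D w (OutA, addr m (int i) (int j)) = Some (decoded_entry m w i j)"
    using ij unfolding stored_def before_def by force
  moreover have "addr m (int i) (int j) = int l + 1" 
    using ij by (simp add: addr_def l' of_nat_diff)
  ultimately show ?thesis using nth_decode[OF ij] by (simp add: l')
qed

end

theory Submission
  imports Defs
begin

text \<open>
  The look-up table is a product: it holds one quotient and one remainder for each of the
  \<open>m * n\<close> symbols and each of the \<open>n\<close> divisors, hence \<open>2 * m * n ^ 2\<close> integers
  (\<open>storage_space_eq\<close>).

  The working memory is bounded by one set of addresses, \<open>workspace m n\<close>, which depends on \<open>m\<close> and \<open>n\<close> only, has at most
  \<open>14 * m * n\<close> elements (\<open>card_workspace_le\<close>) and contains every address that any run writes
  to (\<open>run_confined\<close>). That set consists of the scalars, three arrays with one cell per position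
  of the word, one array of \<open>n\<close> and one of \<open>m\<close> counters, and two arrays with one majority per
  block. All writes but one kind go to a scalar or to an address computed from loop counters, so
  that they are confined for syntactic reasons. The exception is the increment of a counter, whose
  index is a computed label or shift. It lies in range because step 1 has stored the true labels
  and shifts, which are below \<open>n\<close> and \<open>m\<close> for words over \<open>{1..m * n}\<close>
  (\<open>find_majority_confined\<close>, \<open>step2_confined\<close>).

  The bound is uniform in the received word and so passes to the maximum, which is taken over a
  finite set that contains the identity element and is therefore not empty.
\<close>

section \<open>The look-up table\<close>

lemma dom_lookup_table: "dom (lookup_table m n D) = {1..int (m * n)} \<times> D \<times> UNIV"
  by (auto simp: lookup_table_def dom_def split: if_splits)

lemma UNIV_pair_component: "UNIV = {Quotient, Remainder}"
  using pair_component.exhaust by auto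

lemma storage_space_eq: "storage_space m n D = 2 * (m * n * card D)"
proof -
  have "card (UNIV :: pair_component set) = 2"
    unfolding UNIV_pair_component by simp
  then show ?thesis
    by (simp add: storage_space_def space_of_def dom_lookup_table card_cartesian_product
        del: of_nat_mult)
qed

section \<open>The addresses in use\<close>

definition workspace :: "nat \<Rightarrow> nat \<Rightarrow> (array \<times> int) set" where
  "workspace m n =
     {BlockV, PosV, AddrV, SymV, QuotV, RemV, ResV} \<times> {0} \<union>
     {LabelA, ShiftA, OutA} \<times> {1..int (m * n)} \<union>
     {LabelCnt} \<times> {0..<int n} \<union> {ShiftCnt} \<times> {0..<int m} \<union>
     {LabelMaj, ShiftMaj} \<times> {1..int n}"

lemma finite_workspace: "finite (workspace m n)"
  by (simp add: workspace_def)

text \<open>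
  The seven scalars, \<open>3 * m * n\<close> cells for positions, \<open>n + m\<close> counters and \<open>2 * n\<close> majorities
  number at most \<open>(7 + 3 + 2 + 2) * m * n\<close> since \<open>1\<close>, \<open>m\<close> and \<open>n\<close> are at most \<open>m * n\<close>.
\<close>

lemma card_workspace_le:
  assumes "0 < m" "0 < n"
  shows "card (workspace m n) \<le> 14 * (m * n)"
proof -
  have "card (workspace m n) \<le> 7 + 3 * (m * n) + n + m + 2 * n"
    unfolding workspace_def
    by (intro card_Un_le[THEN order_trans] add_mono)
      (simp_all add: card_cartesian_product del: of_nat_mult)
  moreover have "m \<le> m * n" "n \<le> m * n" "1 \<le> m * n"
    using assms by (simp_all add: Suc_leI)
  ultimately show ?thesis by linarith
qed

lemma addr_range:
  assumes "1 \<le> i" "i \<le> int n" "1 \<le> j" "j \<le> int m"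
  shows "1 \<le> addr m i j" "addr m i j \<le> int m * int n"
proof -
  have "0 \<le> int m * (i - 1)" using assms by simp
  then show "1 \<le> addr m i j" using assms unfolding addr_def by linarith
  have "int m * (i - 1) + int m = int m * i" by (simp add: algebra_simps)
  also have "\<dots> \<le> int m * int n" using assms by (intro mult_left_mono) auto
  finally show "addr m i j \<le> int m * int n" using assms unfolding addr_def by linarith
qed

definition confined :: "nat \<Rightarrow> nat \<Rightarrow> memory \<Rightarrow> bool" where
  "confined m n M \<longleftrightarrow> dom M \<subseteq> workspace m n"

lemma confined_update:
  "confined m n M \<Longrightarrow> p \<in> workspace m n \<Longrightarrow> confined m n (M(p \<mapsto> v))"
  by (simp add: confined_def)

section \<open>Confinement of the three steps\<close>

text \<open>
  A one-predicate Hoare triple; its rules follow the syntax of programs, so that confinement of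
  a step reduces to confinement of its loop bodies.
\<close>

definition preserves ::
  "(int \<times> int \<times> pair_component \<Rightarrow> int option) \<Rightarrow> int list \<Rightarrow> (memory \<Rightarrow> bool) \<Rightarrow> com \<Rightarrow> bool"
  where "preserves T w Inv c \<longleftrightarrow> (\<forall>M. Inv M \<longrightarrow> Inv (exec T w c M))"

lemma preserves_Seq:
  "preserves T w Inv c \<Longrightarrow> preserves T w Inv d \<Longrightarrow> preserves T w Inv (c ;; d)"
  by (simp add: preserves_def)

lemma preserves_For:
  assumes "l \<le> h + 1"
    and "\<And>k M. l \<le> k \<Longrightarrow> k \<le> h \<Longrightarrow> Inv M \<Longrightarrow> Inv (exec T w c (M((x, 0) \<mapsto> k)))"
  shows "preserves T w Inv (For x (Const l) (Const h) c)"
  unfolding preserves_def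
proof (intro allI impI)
  fix M assume "Inv M"
  then show "Inv (exec T w (For x (Const l) (Const h) c) M)"
    by (intro exec_For[where P = "\<lambda>_. Inv" and l = l]) (use assms in auto)
qed

text \<open>
  The address of a write is recomputed from the block counter in each iteration, so confinement
  alone is not inductive within a block: the value of that counter has to be carried along.
\<close>

definition in_block :: "nat \<Rightarrow> nat \<Rightarrow> int \<Rightarrow> memory \<Rightarrow> bool" where
  "in_block m n i M \<longleftrightarrow> confined m n M \<and> M (BlockV, 0) = Some i"

text \<open>
  Steps 1 and 3 are nested loops of this form, whose bodies write to addresses that depend on
  the two loop counters alone.
\<close>

lemma nested_loops_confined:
  assumes "\<And>i j M. \<lbrakk>1 \<le> i; i \<le> int n; 1 \<le> j; j \<le> int m; in_block m n i M\<rbrakk>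
     \<Longrightarrow> in_block m n i (exec T w c (M((PosV, 0) \<mapsto> j)))"
  shows "preserves T w (confined m n)
    (For BlockV (Const 1) (Const (int n)) (For PosV (Const 1) (Const (int m)) c))"
proof (rule preserves_For)
  fix i M assume i: "1 \<le> i" "i \<le> int n" and M: "confined m n M"
  have "preserves T w (in_block m n i) (For PosV (Const 1) (Const (int m)) c)"
    by (rule preserves_For) (use assms i in auto)
  moreover have "in_block m n i (M((BlockV, 0) \<mapsto> i))"
    using M by (simp add: in_block_def confined_update workspace_def)
  ultimately show
    "confined m n (exec T w (For PosV (Const 1) (Const (int m)) c) (M((BlockV, 0) \<mapsto> i)))"
    unfolding preserves_def in_block_def by blast
qed simp

lemma step1_confined: "preserves T w (confined m n) (step1 m n)"
  unfolding step1_def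
proof (rule nested_loops_confined, goal_cases)
  case (1 i j M)
  then show ?case
    using addr_range[OF 1(1-4)]
    by (simp add: in_block_def exec_set_addr[where i = i and j = j] confined_update workspace_def)
qed

lemma step3_confined: "preserves T w (confined m n) (step3 m n)"
  unfolding step3_def
proof (rule nested_loops_confined, goal_cases)
  case (1 i j M)
  then show ?case
    using addr_range[OF 1(1-4)]
    by (simp add: in_block_def exec_set_addr[where i = i and j = j] confined_update workspace_def)
qed

text \<open>
  In step 2 the labels and shifts index the counters. The range of their values is
  inherited from the memory \<open>M\<close> left by step 1, since none of these cells is overwritten.
\<close>

definition same_symbols :: "memory \<Rightarrow> memory \<Rightarrow> bool" where
  "same_symbols M N \<longleftrightarrow> (\<forall>s. N (LabelA, s) = M (LabelA, s) \<and> N (ShiftA, s) = M (ShiftA, s))"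

text \<open>
  Only the second loop writes to an address that depends on the input: it increments the counter
  of a symbol read from \<open>a\<close>. The hypothesis that the symbols of the block are below \<open>k\<close> keeps
  this write within the counter array.
\<close>

lemma find_majority_confined:
  assumes i: "1 \<le> i" "i \<le> int n" and m: "m > 0" and n: "n > 0"
    and f: "\<And>j. 1 \<le> j \<Longrightarrow> j \<le> int m \<Longrightarrow>
      \<exists>v. M\<^sub>0 (a, addr m i j) = Some v \<and> 0 \<le> v \<and> v < int k"
    and a: "(a, cnt, maj, k) \<in> {(LabelA, LabelCnt, LabelMaj, n), (ShiftA, ShiftCnt, ShiftMaj, m)}"
  shows "preserves T w (\<lambda>N. in_block m n i N \<and> same_symbols M\<^sub>0 N) (find_majority m k a cnt maj)"
  unfolding find_majority_def
proof (intro preserves_Seq preserves_For, goal_cases)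
  case (2 s N)
  then show ?case
    using a by (auto simp: in_block_def same_symbols_def confined_update workspace_def)
next
  case (4 j N)
  from f[OF 4(1,2)] obtain v where v: "M\<^sub>0 (a, addr m i j) = Some v" "0 \<le> v" "v < int k"
    by blast
  have "N (a, addr m i j) = Some v"
    using 4 a v(1) by (auto simp: same_symbols_def)
  then show ?case
    using 4 a v(2,3) addr_range[OF i 4(1,2)]
    by (auto simp: in_block_def same_symbols_def exec_set_addr[where i = i and j = j]
        confined_update workspace_def)
next
  case 5
  then show ?case
    using a i
    by (auto simp: preserves_def in_block_def same_symbols_def confined_update workspace_def)
next
  case (7 s N)
  then show ?case
    using a i by (auto simp: in_block_def same_symbols_def confined_update workspace_def)
qed (use a m n in auto)

lemma step2_confined:
  assumes w: "w \<in> received_words m n" and m: "m > 0" and n: "n > 0"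
    and L: "stored m n (block_label m w) LabelA (int n + 1) 1 M"
    and S: "stored m n (shift m w) ShiftA (int n + 1) 1 M"
    and M: "confined m n M"
  shows "confined m n (exec T w (step2 m n) M)"
proof -
  let ?Inv = "\<lambda>N. confined m n N \<and> same_symbols M N"
  have "preserves T w ?Inv (step2 m n)"
    unfolding step2_def
  proof (rule preserves_For)
    fix i N assume i: "1 \<le> i" "i \<le> int n" and N: "?Inv N"
    let ?J = "\<lambda>N. in_block m n i N \<and> same_symbols M N"
    \<comment> \<open>Every block precedes block \<open>n + 1\<close>, so the symbols of block \<open>i\<close> are all stored.\<close>
    have bef: "before (int n + 1) 1 i j" for j
      using i by (simp add: before_def)
    have "preserves T w ?J (find_majority m n LabelA LabelCnt LabelMaj ;;
        find_majority m m ShiftA ShiftCnt ShiftMaj)"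
    proof (intro preserves_Seq find_majority_confined[OF i m n], goal_cases)
      case (1 j)
      have "0 \<le> block_label m w (nat i) (nat j) \<and> block_label m w (nat i) (nat j) < int n"
        by (rule block_label_range[OF w]) (use i 1 in auto)
      then show ?case using L i 1 bef by (auto simp: stored_def)
    next
      case (3 j)
      then show ?case using S i bef shift_range[OF m] by (auto simp: stored_def)
    qed auto
    moreover have "?J (N((BlockV, 0) \<mapsto> i))"
      using N by (simp add: in_block_def same_symbols_def confined_update workspace_def)
    ultimately show "?Inv (exec T w (find_majority m n LabelA LabelCnt LabelMaj ;;
        find_majority m m ShiftA ShiftCnt ShiftMaj) (N((BlockV, 0) \<mapsto> i)))"
      unfolding preserves_def in_block_def by blast
  qed simp
  then show ?thesis
    using M by (simp add: preserves_def same_symbols_def)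
qed

lemma run_confined:
  assumes w: "w \<in> received_words m n" and D: "int m \<in> D" and m: "m > 0" and n: "n > 0"
  shows "confined m n (run m n D w)"
proof -
  let ?T = "lookup_table m n D"
  define M where "M = exec ?T w (step1 m n) Map.empty"
  have "confined m n M"
    using step1_confined[of ?T w m n] by (simp add: M_def preserves_def confined_def)
  then have "confined m n (exec ?T w (step2 m n) M)"
    using step2_confined[OF w m n] step1_correct[OF w D m] unfolding M_def by blast
  then show ?thesis
    using step3_confined[of ?T w m n]
    by (simp add: run_def decoder_def M_def preserves_def)
qed

section \<open>The maximum over all received words\<close>

lemma finite_received_words: "finite (received_words m n)"
proof (rule finite_subset)
  show "received_words m n \<subseteq> {w. set w \<subseteq> {1..int (m * n)} \<and> length w = m * n}"
    by (auto simp: received_words_def)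
  show "finite {w. set w \<subseteq> {1..int (m * n)} \<and> length w = m * n}"
    by (rule finite_lists_length_eq) simp
qed

lemma is_majority_replicate: "0 < k \<Longrightarrow> is_majority (replicate k x) x"
  by (simp add: is_majority_def)

text \<open>
  The identity of the group is a codeword: all labels of its block \<open>i\<close> are \<open>i - 1\<close> and all its
  shifts are \<open>0\<close>, so the majorities exist. Without such a word the maximum in the definition of
  the working space would be that of the empty set.
\<close>

lemma identity_received:
  assumes m: "0 < m" and n: "0 < n"
  shows "[1..int (m * n)] \<in> received_words m n"
proof -
  let ?w = "[1..int (m * n)]"
  have "(\<exists>b. is_majority (label_list m ?w i) b) \<and> (\<exists>c. is_majority (shift_list m ?w i) c)"
    if i: "i \<in> {1..n}" for i
  proof -
    have e: "entry m ?w i j = int j + int (i - 1) * int m" if j: "j \<in> {1..m}" for j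
    proof -
      have "int (m * (i - 1) + (j - 1)) < int (m * n)"
        using addr_less[OF i j] by (simp only: of_nat_less_iff)
      then have "entry m ?w i j = 1 + int (m * (i - 1) + (j - 1))"
        unfolding entry_def by (subst nth_upto) linarith+
      also have "\<dots> = int j + int (i - 1) * int m"
        using j by (cases j) (simp_all add: mult.commute)
      finally show ?thesis .
    qed
    have l: "block_label m ?w i j = int (i - 1)" if j: "j \<in> {1..m}" for j
    \<comment> \<open>The last symbol of a block is the multiple of \<open>m\<close>, whose quotient is corrected by 1.\<close>
    proof (cases "j = m")
      case True
      then show ?thesis using m unfolding block_label_def Let_def e[OF j] by simp
    next
      case False
      then have "int j mod int m = int j" "int j div int m = 0" using j by auto
      then show ?thesis using m j unfolding block_label_def Let_def e[OF j] by simp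
    qed
    have s: "shift m ?w i j = 0" if j: "j \<in> {1..m}" for j
      unfolding shift_def e[OF j] by (simp add: mod_simps)
    have "label_list m ?w i = replicate m (int (i - 1))" "shift_list m ?w i = replicate m 0"
      unfolding label_list_def shift_list_def
      by (rule replicate_eqI; use l s in \<open>auto simp del: upt_Suc\<close>)+
    then show ?thesis using is_majority_replicate[OF m] by metis
  qed
  then show ?thesis by (auto simp: received_words_def nat_mult_distrib)
qed

lemma working_space_le:
  assumes "int m \<in> D" "0 < m" "0 < n"
  shows "working_space m n D \<le> 14 * (m * n)"
proof -
  have "space_of (run m n D w) \<le> 14 * (m * n)" if "w \<in> received_words m n" for w
    using run_confined[OF that assms] card_mono[OF finite_workspace] card_workspace_le[OF assms(2,3)]
    unfolding confined_def space_of_def by (meson order_trans)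
  moreover have "received_words m n \<noteq> {}"
    using identity_received[OF assms(2,3)] by blast
  ultimately show ?thesis
    unfolding working_space_def using finite_received_words by (subst Max_le_iff) auto
qed

theorem proposition7:
  fixes D :: "nat \<Rightarrow> nat \<Rightarrow> int set"
  assumes "\<And>m n. 0 < m \<Longrightarrow> 0 < n \<Longrightarrow>
             D m n \<subseteq> {1..} \<and> card (D m n) = n \<and> int m \<in> D m n"
  shows "(\<lambda>(m, n). real (storage_space m n (D m n))) \<in> O[pos_pairs](\<lambda>(m, n). real (m * n ^ 2)) \<and>
         (\<lambda>(m, n). real (working_space m n (D m n))) \<in> O[pos_pairs](\<lambda>(m, n). real (m * n))"
proof
  have "real (storage_space m n (D m n)) \<le> 2 * real (m * n ^ 2)" if "0 < m" "0 < n" for m n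
    using assms[OF that] by (simp add: storage_space_eq power2_eq_square)
  then show "(\<lambda>(m, n). real (storage_space m n (D m n))) \<in> O[pos_pairs](\<lambda>(m, n). real (m * n ^ 2))"
    unfolding pos_pairs_def
    by (intro bigoI[where c = 2]) (auto simp: eventually_principal simp del: of_nat_mult)
  have "real (working_space m n (D m n)) \<le> 14 * real (m * n)" if "0 < m" "0 < n" for m n
  proof -
    have "working_space m n (D m n) \<le> 14 * (m * n)"
      using assms[OF that] that by (intro working_space_le) auto
    then have "real (working_space m n (D m n)) \<le> real (14 * (m * n))"
      by (simp only: of_nat_le_iff)
    then show ?thesis by simp
  qed
  then show "(\<lambda>(m, n). real (working_space m n (D m n))) \<in> O[pos_pairs](\<lambda>(m, n). real (m * n))"
    unfolding pos_pairs_def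
    by (intro bigoI[where c = 14]) (auto simp: eventually_principal simp del: of_nat_mult)
qed

end
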